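(* Suppose $\kappa=\kappa^{\aleph_0}$ is a regular cardinal which is not weakly compact. Then $\mathrm{onto}^+(J^{\mathrm{bd}}[\kappa],\omega)$ holds.
   Context: An uncountable cardinal is weakly compact iff $\kappa\to[\kappa]^2_2$. $J^{\mathrm{bd}}[\kappa]$ is the ideal of bounded subsets of $\kappa$, whose positive sets are the cofinal subsets. $\mathrm{onto}^+(J^{\mathrm{bd}}[\kappa],\omega)$ asserts the existence of a colouring $c:[\kappa]^2\to\omega$ (on pairs $\alpha<\beta<\kappa$) such that for every cofinal $B\subseteq\kappa$ there is $\eta<\kappa$ such that for every $n<\omega$ the set $\{\beta\in B\setminus(\eta+1)\mid c(\eta,\beta)=n\}$ is cofinal in $\kappa$. *)

theory Defs
  imports Main
begin

unbundle cardinal_syntax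

text \<open>
  A cardinal is represented, as in the library, by a well-order \<open>\<kappa>\<close> with \<open>Card_order \<kappa>\<close>. The
  elements of \<open>Field \<kappa>\<close> play the role of the ordinals below \<open>\<kappa>\<close>.
\<close>

definition below :: "'a rel \<Rightarrow> 'a \<Rightarrow> 'a \<Rightarrow> bool" where
  "below \<kappa> \<alpha> \<beta> \<longleftrightarrow> (\<alpha>, \<beta>) \<in> \<kappa> \<and> \<alpha> \<noteq> \<beta>"

text \<open>
  \<open>pair_colouring \<kappa> T c\<close> means \<open>c : [\<kappa>]\<^sup>2 \<rightarrow> T\<close>: only the values \<open>c \<alpha> \<beta>\<close> with
  \<open>\<alpha> < \<beta> < \<kappa>\<close> are relevant.
\<close>

definition pair_colouring :: "'a rel \<Rightarrow> 'c set \<Rightarrow> ('a \<Rightarrow> 'a \<Rightarrow> 'c) \<Rightarrow> bool" where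
  "pair_colouring \<kappa> T c \<longleftrightarrow> (\<forall>\<alpha> \<beta>. below \<kappa> \<alpha> \<beta> \<longrightarrow> c \<alpha> \<beta> \<in> T)"

text \<open>
  The square-bracket relation \<open>\<kappa> \<rightarrow> [\<kappa>]\<^sup>2\<^sub>T\<close>: every colouring of pairs with colours in \<open>T\<close> omits a
  colour on the pairs of some set of size \<open>\<kappa>\<close>.
\<close>

definition square_arrow :: "'a rel \<Rightarrow> 'c set \<Rightarrow> bool" where
  "square_arrow \<kappa> T \<longleftrightarrow>
    (\<forall>c. pair_colouring \<kappa> T c \<longrightarrow>
      (\<exists>H. H \<subseteq> Field \<kappa> \<and> |H| =o \<kappa> \<and>
        {c \<alpha> \<beta> | \<alpha> \<beta>. \<alpha> \<in> H \<and> \<beta> \<in> H \<and> below \<kappa> \<alpha> \<beta>} \<noteq> T))"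

definition weakly_compact :: "'a rel \<Rightarrow> bool" where
  "weakly_compact \<kappa> \<longleftrightarrow>
    Card_order \<kappa> \<and> natLeq <o \<kappa> \<and> square_arrow \<kappa> (UNIV :: bool set)"

definition bounded_ideal :: "'a rel \<Rightarrow> 'a set set" where
  "bounded_ideal \<kappa> = {X. X \<subseteq> Field \<kappa> \<and> (\<exists>\<gamma>\<in>Field \<kappa>. \<forall>\<xi>\<in>X. (\<xi>, \<gamma>) \<in> \<kappa>)}"

definition positive_sets :: "'a rel \<Rightarrow> 'a set set \<Rightarrow> 'a set set" where
  "positive_sets \<kappa> J = {X. X \<subseteq> Field \<kappa> \<and> X \<notin> J}"

definition onto_plus :: "'a rel \<Rightarrow> 'a set set \<Rightarrow> 'c set \<Rightarrow> bool" where
  "onto_plus \<kappa> J T \<longleftrightarrow>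
    (\<exists>c. pair_colouring \<kappa> T c \<and>
      (\<forall>B\<in>positive_sets \<kappa> J. \<exists>\<eta>\<in>Field \<kappa>. \<forall>\<tau>\<in>T.
        {\<beta> \<in> B. below \<kappa> \<eta> \<beta> \<and> c \<eta> \<beta> = \<tau>} \<in> positive_sets \<kappa> J))"

lemma positive_sets_bounded_ideal:
  assumes "Card_order \<kappa>"
  shows "positive_sets \<kappa> (bounded_ideal \<kappa>) = {X. X \<subseteq> Field \<kappa> \<and> cofinal X \<kappa>}"
proof -
  have wo: "Well_order \<kappa>"
    using assms by (simp add: card_order_on_def)
  have iff: "(x, a) \<notin> \<kappa> \<longleftrightarrow> a \<noteq> x \<and> (a, x) \<in> \<kappa>" if "x \<in> Field \<kappa>" "a \<in> Field \<kappa>" for x a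
    using wo that
    unfolding well_order_on_def linear_order_on_def partial_order_on_def preorder_on_def
      total_on_def refl_on_def antisym_def
    by metis
  show ?thesis
    unfolding positive_sets_def bounded_ideal_def cofinal_def
    using iff by (auto; metis subsetD)
qed

end

theory Submission
  imports Defs
begin

text \<open>
  A colouring \<open>d : [\<kappa>]\<^sup>2 \<rightarrow> 2\<close> without homogeneous sets of size \<open>\<kappa>\<close> splits every cofinal set:
  some \<open>\<eta>\<close> sees both colours cofinally often in it. Given a cofinal \<open>B\<close>, split \<open>B\<^sub>0 = B\<close> by
  some \<open>\<eta>\<^sub>0\<close>, let \<open>B\<^sub>1\<close> be the part of colour 0, split it by some \<open>\<eta>\<^sub>1\<close>, and so on. As
  \<open>\<kappa>\<^sup>\<omega> = \<kappa>\<close>, every sequence \<open>\<langle>\<eta>\<^sub>n | n < \<omega>\<rangle>\<close> is coded by a single \<open>\<eta> < \<kappa>\<close>, and the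
  colouring sending \<open>(\<eta>, \<beta>)\<close> to the least \<open>n\<close> with \<open>d(\<eta>\<^sub>n, \<beta>) = 1\<close> is as desired.
\<close>

section \<open>Bounded and cofinal subsets of a well-order\<close>

lemma not_below_iff:
  assumes "Well_order \<kappa>" "\<alpha> \<in> Field \<kappa>" "\<beta> \<in> Field \<kappa>"
  shows "\<not> below \<kappa> \<alpha> \<beta> \<longleftrightarrow> (\<beta>, \<alpha>) \<in> \<kappa>"
  using assms
  unfolding below_def well_order_on_def linear_order_on_def partial_order_on_def preorder_on_def
    total_on_def refl_on_def antisym_def
  by metis

lemma below_le_trans:
  assumes "Well_order \<kappa>" "(\<alpha>, \<beta>) \<in> \<kappa>" "below \<kappa> \<beta> \<gamma>"
  shows "below \<kappa> \<alpha> \<gamma>"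
  using assms
  unfolding below_def well_order_on_def linear_order_on_def partial_order_on_def preorder_on_def
    trans_def antisym_def
  by metis

lemma below_Field: "below \<kappa> \<alpha> \<beta> \<Longrightarrow> \<alpha> \<in> Field \<kappa> \<and> \<beta> \<in> Field \<kappa>"
  by (auto simp: below_def Field_def)

lemma cofinal_iff_below: "cofinal X \<kappa> \<longleftrightarrow> (\<forall>\<gamma>\<in>Field \<kappa>. \<exists>\<beta>\<in>X. below \<kappa> \<gamma> \<beta>)"
  by (auto simp: cofinal_def below_def)

lemma not_cofinal_iff_bounded:
  assumes "Well_order \<kappa>" "X \<subseteq> Field \<kappa>"
  shows "\<not> cofinal X \<kappa> \<longleftrightarrow> (\<exists>\<gamma>\<in>Field \<kappa>. \<forall>\<xi>\<in>X. (\<xi>, \<gamma>) \<in> \<kappa>)"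
  unfolding cofinal_iff_below using not_below_iff[OF assms(1)] assms(2) by blast

lemma Well_order_upper_bound:
  assumes "Well_order \<kappa>" "\<alpha> \<in> Field \<kappa>" "\<beta> \<in> Field \<kappa>"
  obtains \<gamma> where "\<gamma> \<in> Field \<kappa>" "(\<alpha>, \<gamma>) \<in> \<kappa>" "(\<beta>, \<gamma>) \<in> \<kappa>"
  using assms
  unfolding well_order_on_def linear_order_on_def partial_order_on_def preorder_on_def
    total_on_def refl_on_def
  by metis

lemma cofinal_Un:
  assumes "Well_order \<kappa>" "X \<union> Y \<subseteq> Field \<kappa>" "cofinal (X \<union> Y) \<kappa>"
  shows "cofinal X \<kappa> \<or> cofinal Y \<kappa>"
proof (rule ccontr)
  assume "\<not> ?thesis"
  then obtain \<alpha> \<beta> where \<alpha>: "\<alpha> \<in> Field \<kappa>" "\<forall>\<gamma>\<in>X. \<not> below \<kappa> \<alpha> \<gamma>"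
    and \<beta>: "\<beta> \<in> Field \<kappa>" "\<forall>\<gamma>\<in>Y. \<not> below \<kappa> \<beta> \<gamma>"
    unfolding cofinal_iff_below by blast
  obtain \<delta> where \<delta>: "\<delta> \<in> Field \<kappa>" "(\<alpha>, \<delta>) \<in> \<kappa>" "(\<beta>, \<delta>) \<in> \<kappa>"
    using Well_order_upper_bound[OF assms(1) \<alpha>(1) \<beta>(1)] .
  obtain \<gamma> where "\<gamma> \<in> X \<union> Y" "below \<kappa> \<delta> \<gamma>"
    using assms(3) \<delta>(1) unfolding cofinal_iff_below by blast
  then show False
    using below_le_trans[OF assms(1)] \<alpha>(2) \<beta>(2) \<delta>(2,3) by blast
qed

lemma cofinal_above:
  assumes "Well_order \<kappa>" "cofinal X \<kappa>" "\<eta> \<in> Field \<kappa>"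
  shows "cofinal {\<beta> \<in> X. below \<kappa> \<eta> \<beta>} \<kappa>"
  unfolding cofinal_iff_below
proof
  fix \<gamma> assume "\<gamma> \<in> Field \<kappa>"
  then obtain \<delta> where \<delta>: "\<delta> \<in> Field \<kappa>" "(\<gamma>, \<delta>) \<in> \<kappa>" "(\<eta>, \<delta>) \<in> \<kappa>"
    using Well_order_upper_bound[OF assms(1) _ assms(3)] by blast
  then obtain \<beta> where "\<beta> \<in> X" "below \<kappa> \<delta> \<beta>"
    using assms(2) unfolding cofinal_iff_below by blast
  then show "\<exists>\<beta>\<in>{\<beta> \<in> X. below \<kappa> \<eta> \<beta>}. below \<kappa> \<gamma> \<beta>"
    using below_le_trans[OF assms(1)] \<delta>(2,3) by blast
qed

text \<open>An infinite cardinal has no last element, so some \<delta> lies strictly above a bound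
  of \<open>X\<close>. Then \<open>X\<close> sits inside the proper initial segment below \<delta>,
  which is smaller than a cardinal.\<close>

lemma bounded_card_less:
  assumes "Cinfinite \<kappa>" "X \<subseteq> Field \<kappa>" "\<not> cofinal X \<kappa>"
  shows "|X| <o \<kappa>"
proof -
  have co: "Card_order \<kappa>" and wo: "Well_order \<kappa>"
    using assms(1) by (auto simp: card_order_on_def)
  obtain \<gamma> where \<gamma>: "\<gamma> \<in> Field \<kappa>" "\<forall>\<xi>\<in>X. (\<xi>, \<gamma>) \<in> \<kappa>"
    using not_cofinal_iff_bounded[OF wo assms(2)] assms(3) by blast
  obtain \<delta> where \<delta>: "\<delta> \<in> Field \<kappa>" "below \<kappa> \<gamma> \<delta>"
    using infinite_Card_order_limit[OF co _ \<gamma>(1)] assms(1)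
    unfolding cinfinite_def below_def by auto
  have "X \<subseteq> underS \<kappa> \<delta>"
    using below_le_trans[OF wo _ \<delta>(2)] \<gamma>(2) unfolding underS_def below_def by blast
  then show ?thesis
    using card_of_mono1 card_of_underS[OF co \<delta>(1)] ordLeq_ordLess_trans by blast
qed

section \<open>Sparse sets and splitting at a regular cardinal\<close>

lemma regularCard_small_bounded:
  assumes "regularCard \<kappa>" "X \<subseteq> Field \<kappa>" "|X| <o \<kappa>"
  shows "\<not> cofinal X \<kappa>"
  using assms not_ordLess_ordIso unfolding regularCard_def by blast

lemma regularCard_cofinal_sparse_subset:
  assumes inf: "Cinfinite \<kappa>" and reg: "regularCard \<kappa>"
    and B: "B \<subseteq> Field \<kappa>" "cofinal B \<kappa>"
    and g: "g ` B \<subseteq> Field \<kappa>"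
  shows "\<exists>H\<subseteq>B. cofinal H \<kappa> \<and> (\<forall>\<eta>\<in>H. \<forall>\<beta>\<in>H. below \<kappa> \<eta> \<beta> \<longrightarrow> below \<kappa> (g \<eta>) \<beta>)"
proof -
  have wo: "Well_order \<kappa>"
    using inf by (auto simp: card_order_on_def)
  define sparse where "sparse H \<longleftrightarrow>
      H \<subseteq> B \<and> (\<forall>\<eta>\<in>H. \<forall>\<beta>\<in>H. below \<kappa> \<eta> \<beta> \<longrightarrow> below \<kappa> (g \<eta>) \<beta>)" for H
  have "\<exists>M\<in>Collect sparse. \<forall>H\<in>Collect sparse. M \<subseteq> H \<longrightarrow> H = M"
  proof (rule subset_Zorn')
    fix \<C> assume chain: "subset.chain (Collect sparse) \<C>"
    \<comment> \<open>Sparseness concerns only pairs, and two elements of the union of a chain lie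
      in a common member.\<close>
    have "below \<kappa> (g \<eta>) \<beta>" if mem: "\<eta> \<in> \<Union>\<C>" "\<beta> \<in> \<Union>\<C>" and lt: "below \<kappa> \<eta> \<beta>" for \<eta> \<beta>
    proof -
      obtain H where "H \<in> \<C>" "\<eta> \<in> H" "\<beta> \<in> H"
        using mem chain unfolding subset_chain_def by (metis UnionE subsetD)
      then show ?thesis
        using chain lt unfolding subset_chain_def sparse_def by blast
    qed
    then show "\<Union>\<C> \<in> Collect sparse"
      using chain unfolding subset_chain_def sparse_def by blast
  qed
  then obtain M where M: "sparse M" and max: "\<And>H. sparse H \<Longrightarrow> M \<subseteq> H \<Longrightarrow> H = M"
    by blast
  have MF: "M \<subseteq> Field \<kappa>"
    using M B(1) unfolding sparse_def by blast
  have "cofinal M \<kappa>"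
  proof (rule ccontr)
    assume nc: "\<not> cofinal M \<kappa>"
    have "|g ` M| <o \<kappa>"
      using card_of_image bounded_card_less[OF inf MF nc] ordLeq_ordLess_trans by blast
    moreover have gF: "g ` M \<subseteq> Field \<kappa>"
      using g M unfolding sparse_def by blast
    ultimately have "\<not> cofinal (g ` M) \<kappa>"
      using regularCard_small_bounded[OF reg] by blast
    then have "\<not> cofinal (M \<union> g ` M) \<kappa>"
      using cofinal_Un[OF wo] nc MF gF by blast
    then obtain \<gamma> where \<gamma>: "\<gamma> \<in> Field \<kappa>" "\<forall>\<xi>\<in>M \<union> g ` M. (\<xi>, \<gamma>) \<in> \<kappa>"
      using not_cofinal_iff_bounded[OF wo] MF gF by (meson Un_least)
    then obtain \<beta> where \<beta>: "\<beta> \<in> B" "below \<kappa> \<gamma> \<beta>"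
      using B(2) unfolding cofinal_iff_below by blast
    have above: "below \<kappa> \<xi> \<beta>" if "\<xi> \<in> M \<union> g ` M" for \<xi>
      using below_le_trans[OF wo _ \<beta>(2)] \<gamma>(2) that by blast
    \<comment> \<open>The new point \<beta> is never the smaller one of a pair, so nothing is
      required of \<open>g \<beta>\<close>.\<close>
    have "\<not> below \<kappa> \<beta> \<xi>" if "\<xi> \<in> insert \<beta> M" for \<xi>
    proof (cases "\<xi> = \<beta>")
      case False
      then have "below \<kappa> \<xi> \<beta>"
        using above that by blast
      then show ?thesis
        using not_below_iff[OF wo] below_Field unfolding below_def by metis
    qed (simp add: below_def)
    then have "sparse (insert \<beta> M)"
      using M \<beta>(1) above unfolding sparse_def by blast
    then have "\<beta> \<in> M"
      using max by blast
    then show False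
      using above unfolding below_def by blast
  qed
  then show ?thesis
    using M unfolding sparse_def by blast
qed

text \<open>
  If no \<open>\<eta>\<close> splits \<open>B\<close>, then \<open>d \<eta> \<beta>\<close> is eventually constant in \<open>\<beta> \<in> B\<close> for every \<open>\<eta>\<close>, and
  a sufficiently sparse cofinal subset of \<open>B\<close> is homogeneous.
\<close>

lemma cofinal_set_split:
  assumes inf: "Cinfinite \<kappa>" and reg: "regularCard \<kappa>"
    and d: "\<And>H. H \<subseteq> Field \<kappa> \<Longrightarrow> |H| =o \<kappa> \<Longrightarrow>
      {d \<alpha> \<beta> | \<alpha> \<beta>. \<alpha> \<in> H \<and> \<beta> \<in> H \<and> below \<kappa> \<alpha> \<beta>} = (UNIV :: bool set)"
    and B: "B \<subseteq> Field \<kappa>" "cofinal B \<kappa>"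
  shows "\<exists>\<eta>\<in>Field \<kappa>. \<forall>i. cofinal {\<beta> \<in> B. below \<kappa> \<eta> \<beta> \<and> d \<eta> \<beta> = i} \<kappa>"
proof (rule ccontr)
  assume no_split: "\<not> ?thesis"
  have wo: "Well_order \<kappa>"
    using inf by (auto simp: card_order_on_def)
  have "\<exists>i \<gamma>. \<gamma> \<in> Field \<kappa> \<and>
      (\<forall>\<beta>\<in>B. below \<kappa> \<eta> \<beta> \<longrightarrow> below \<kappa> \<gamma> \<beta> \<longrightarrow> d \<eta> \<beta> = i)" if "\<eta> \<in> Field \<kappa>" for \<eta>
  proof -
    obtain i where "\<not> cofinal {\<beta> \<in> B. below \<kappa> \<eta> \<beta> \<and> d \<eta> \<beta> = i} \<kappa>"
      using no_split \<open>\<eta> \<in> Field \<kappa>\<close> by blast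
    then obtain \<gamma> where "\<gamma> \<in> Field \<kappa>"
      "\<forall>\<beta>\<in>B. below \<kappa> \<eta> \<beta> \<longrightarrow> below \<kappa> \<gamma> \<beta> \<longrightarrow> d \<eta> \<beta> \<noteq> i"
      unfolding cofinal_iff_below by blast
    \<comment> \<open>With two colours, avoiding \<open>i\<close> beyond \<gamma> means having the
      constant colour \<open>\<not> i\<close> there.\<close>
    then show ?thesis
      by (intro exI[of _ "\<not> i"] exI[of _ \<gamma>]) blast
  qed
  then obtain f g where g: "\<And>\<eta>. \<eta> \<in> Field \<kappa> \<Longrightarrow> g \<eta> \<in> Field \<kappa>"
    and f: "\<And>\<eta> \<beta>. \<eta> \<in> Field \<kappa> \<Longrightarrow> \<beta> \<in> B \<Longrightarrow> below \<kappa> \<eta> \<beta> \<Longrightarrow> below \<kappa> (g \<eta>) \<beta> \<Longrightarrow> d \<eta> \<beta> = f \<eta>"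
    by metis
  \<comment> \<open>Some eventual colour \<open>i\<close> is shared by cofinally many \<eta> in
    \<open>B\<close>. Thinning these out makes each pair come after the stabilisation point
    \<open>g\<close> of its smaller element.\<close>
  have "B = {\<eta> \<in> B. f \<eta> = True} \<union> {\<eta> \<in> B. f \<eta> = False}"
    by blast
  then have "cofinal {\<eta> \<in> B. f \<eta> = True} \<kappa> \<or> cofinal {\<eta> \<in> B. f \<eta> = False} \<kappa>"
    using cofinal_Un[OF wo] B by metis
  then obtain i where i: "cofinal {\<eta> \<in> B. f \<eta> = i} \<kappa>"
    by (elim disjE) (rule that)
  have BiF: "{\<eta> \<in> B. f \<eta> = i} \<subseteq> Field \<kappa>"
    using B(1) by blast
  have giF: "g ` {\<eta> \<in> B. f \<eta> = i} \<subseteq> Field \<kappa>"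
    using g BiF by blast
  obtain H where H: "H \<subseteq> {\<eta> \<in> B. f \<eta> = i}" "cofinal H \<kappa>"
    "\<forall>\<eta>\<in>H. \<forall>\<beta>\<in>H. below \<kappa> \<eta> \<beta> \<longrightarrow> below \<kappa> (g \<eta>) \<beta>"
    using regularCard_cofinal_sparse_subset[OF inf reg BiF i giF] by blast
  have "H \<subseteq> Field \<kappa>"
    using H(1) B(1) by blast
  moreover have "|H| =o \<kappa>"
    using reg H(2) \<open>H \<subseteq> Field \<kappa>\<close> unfolding regularCard_def by blast
  \<comment> \<open>All pairs from \<open>H\<close> have colour \<open>i\<close>, whereas
    \<open>d\<close> takes both colours on every set of size \<kappa>.\<close>
  ultimately have "(\<not> i) \<in> {d \<alpha> \<beta> | \<alpha> \<beta>. \<alpha> \<in> H \<and> \<beta> \<in> H \<and> below \<kappa> \<alpha> \<beta>}"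
    using d by blast
  then obtain \<alpha> \<beta> where "\<alpha> \<in> H" "\<beta> \<in> H" "below \<kappa> \<alpha> \<beta>" "d \<alpha> \<beta> = (\<not> i)"
    by blast
  then show False
    using f[of \<alpha> \<beta>] H(1,3) below_Field by fastforce
qed

section \<open>Consequences of the cardinal arithmetic assumption\<close>

lemma cexp_natLeq_uncountable:
  assumes "Cinfinite \<kappa>" "\<kappa> =o \<kappa> ^c natLeq"
  shows "natLeq <o \<kappa>"
proof -
  \<comment> \<open>By Cantor's theorem, \<open>natLeq\<close> is smaller than
    \<open>ctwo ^c natLeq\<close>, which is at most \<open>\<kappa> ^c natLeq\<close>, that is,
    \<kappa>.\<close>
  have "ctwo \<le>o \<kappa>"
    using assms(1) ctwo_ordLeq_Cinfinite by blast
  then have "ctwo ^c natLeq \<le>o \<kappa> ^c natLeq"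
    by (rule cexp_mono1[OF _ natLeq_Card_order])
  then show ?thesis
    using ordLess_ctwo_cexp[OF natLeq_Card_order] assms(2)
      ordLess_ordLeq_trans ordLeq_ordIso_trans ordIso_symmetric by blast
qed

text \<open>The map \<open>decode\<close> inverts a bijection from the \<omega>-sequences in
  \<open>Field \<kappa>\<close> onto \<open>Field \<kappa>\<close>. It lets one \<eta> carry all the
  splitting points of a cofinal set.\<close>

lemma cexp_natLeq_sequence_coding:
  fixes \<kappa> :: "'a rel"
  assumes "Card_order \<kappa>" "\<kappa> =o \<kappa> ^c natLeq"
  shows "\<exists>decode :: 'a \<Rightarrow> nat \<Rightarrow> 'a.
    \<forall>s. range s \<subseteq> Field \<kappa> \<longrightarrow> (\<exists>\<eta>\<in>Field \<kappa>. decode \<eta> = s)"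
proof -
  have "|Func (UNIV :: nat set) (Field \<kappa>)| =o |Field \<kappa>|"
    using assms(2) card_of_Field_ordIso[OF assms(1)] ordIso_symmetric ordIso_transitive
    unfolding cexp_def Field_natLeq by blast
  then obtain F where F: "bij_betw F (Func (UNIV :: nat set) (Field \<kappa>)) (Field \<kappa>)"
    using card_of_ordIso by blast
  show ?thesis
  proof (intro exI allI impI)
    fix s :: "nat \<Rightarrow> 'a" assume "range s \<subseteq> Field \<kappa>"
    then have "s \<in> Func UNIV (Field \<kappa>)"
      unfolding Func_def by blast
    then show "\<exists>\<eta>\<in>Field \<kappa>. inv_into (Func UNIV (Field \<kappa>)) F \<eta> = s"
      using F bij_betw_inv_into_left bij_betwE by metis
  qed
qed

section \<open>The colouring by the first index of colour \<open>True\<close>\<close>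

theorem theorem10p2:
  fixes \<kappa> :: "'a rel"
  assumes "Cinfinite \<kappa>"
    and "regularCard \<kappa>"
    and "\<kappa> =o \<kappa> ^c natLeq"
    and "\<not> weakly_compact \<kappa>"
  shows "onto_plus \<kappa> (bounded_ideal \<kappa>) (UNIV :: nat set)"
proof -
  have co: "Card_order \<kappa>" and wo: "Well_order \<kappa>"
    using assms(1) by (auto simp: card_order_on_def)
  \<comment> \<open>As \<kappa> is uncountable, only the square-bracket relation can fail.\<close>
  have "\<not> square_arrow \<kappa> (UNIV :: bool set)"
    using assms(4) co cexp_natLeq_uncountable[OF assms(1,3)] unfolding weakly_compact_def by blast
  then obtain d :: "'a \<Rightarrow> 'a \<Rightarrow> bool" where
    "\<not> (\<exists>H. H \<subseteq> Field \<kappa> \<and> |H| =o \<kappa> \<and>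
      {d \<alpha> \<beta> | \<alpha> \<beta>. \<alpha> \<in> H \<and> \<beta> \<in> H \<and> below \<kappa> \<alpha> \<beta>} \<noteq> UNIV)"
    unfolding square_arrow_def not_all not_imp by (elim exE conjE) (rule that)
  then have d: "{d \<alpha> \<beta> | \<alpha> \<beta>. \<alpha> \<in> H \<and> \<beta> \<in> H \<and> below \<kappa> \<alpha> \<beta>} = UNIV"
    if "H \<subseteq> Field \<kappa>" "|H| =o \<kappa>" for H
    using that by (intro ccontr[of "_ = UNIV"]) (erule notE, intro exI conjI)
  obtain decode :: "'a \<Rightarrow> nat \<Rightarrow> 'a" where
    decode: "\<forall>s. range s \<subseteq> Field \<kappa> \<longrightarrow> (\<exists>\<eta>\<in>Field \<kappa>. decode \<eta> = s)"
    using cexp_natLeq_sequence_coding[OF co assms(3)] by blast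
  \<comment> \<open>If no such \<open>n\<close> exists, \<open>LEAST\<close> returns an unspecified
    number; this is harmless, since each colour is verified only at points where a witness
    exists.\<close>
  define c where "c \<eta> \<beta> = (LEAST n. d (decode \<eta> n) \<beta>)" for \<eta> \<beta>
  have "\<exists>\<eta>\<in>Field \<kappa>. \<forall>n. {\<beta> \<in> B. below \<kappa> \<eta> \<beta> \<and> c \<eta> \<beta> = n} \<subseteq> Field \<kappa> \<and>
      cofinal {\<beta> \<in> B. below \<kappa> \<eta> \<beta> \<and> c \<eta> \<beta> = n} \<kappa>"
    if B: "B \<subseteq> Field \<kappa>" "cofinal B \<kappa>" for B
  proof -
    define split where "split X = (SOME \<eta>. \<eta> \<in> Field \<kappa> \<and>
        (\<forall>i. cofinal {\<beta> \<in> X. below \<kappa> \<eta> \<beta> \<and> d \<eta> \<beta> = i} \<kappa>))" for X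
    have split: "split X \<in> Field \<kappa> \<and>
        (\<forall>i. cofinal {\<beta> \<in> X. below \<kappa> (split X) \<beta> \<and> d (split X) \<beta> = i} \<kappa>)"
      if "X \<subseteq> Field \<kappa>" "cofinal X \<kappa>" for X
      unfolding split_def
      using cofinal_set_split[OF assms(1,2) d that, unfolded Bex_def] by (rule someI_ex)
    \<comment> \<open>The sets \<open>A n\<close> decrease; every point of \<open>A n\<close> has
      received colour \<open>False\<close> at all stages before \<open>n\<close>.\<close>
    define A where "A = rec_nat B
      (\<lambda>_ X. {\<beta> \<in> X. below \<kappa> (split X) \<beta> \<and> d (split X) \<beta> = False})"
    have A0: "A 0 = B"
      and AS: "A (Suc n) = {\<beta> \<in> A n. below \<kappa> (split (A n)) \<beta> \<and> d (split (A n)) \<beta> = False}" for n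
      by (simp_all add: A_def)
    have A: "A n \<subseteq> B \<and> cofinal (A n) \<kappa>" for n
    proof (induction n)
      case 0
      then show ?case
        using B by (simp add: A0)
    next
      case (Suc n)
      then show ?case
        unfolding AS using split[of "A n"] B(1) by blast
    qed
    have sp: "split (A n) \<in> Field \<kappa>"
        "cofinal {\<beta> \<in> A n. below \<kappa> (split (A n)) \<beta> \<and> d (split (A n)) \<beta> = True} \<kappa>" for n
      using split[of "A n"] A[of n] B(1) by blast+
    have colour_False: "\<not> d (split (A m)) \<beta>" if "\<beta> \<in> A n" "m < n" for \<beta> m n
      using that by (induction n) (auto simp: AS less_Suc_eq)
    have "range (\<lambda>n. split (A n)) \<subseteq> Field \<kappa>"
      using sp(1) by blast
    then obtain \<eta> where \<eta>: "\<eta> \<in> Field \<kappa>" "decode \<eta> = (\<lambda>n. split (A n))"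
      using decode by meson
    have "cofinal {\<beta> \<in> B. below \<kappa> \<eta> \<beta> \<and> c \<eta> \<beta> = n} \<kappa>" for n
    proof -
      \<comment> \<open>Stage \<open>n\<close> is the first with colour \<open>True\<close>:
        membership in \<open>A n\<close> rules out all earlier ones.\<close>
      have least: "c \<eta> \<beta> = n" if "\<beta> \<in> A n" "d (split (A n)) \<beta>" for \<beta>
        unfolding c_def \<eta>(2)
        using that colour_False[OF that(1)] by (intro Least_equality) (auto simp: not_less[symmetric])
      \<comment> \<open>The code \<eta> need not lie below these \<beta>, but restricting to the
        points above \<eta> keeps the set cofinal.\<close>
      show ?thesis
        using cofinal_above[OF wo sp(2)[of n] \<eta>(1)] least A[of n]
        unfolding cofinal_iff_below by blast
    qed
    then show ?thesis
      using \<eta>(1) B(1) by blast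
  qed
  then show ?thesis
    unfolding onto_plus_def pair_colouring_def positive_sets_bounded_ideal[OF co]
    by (intro exI[of _ c]) simp
qed

end
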